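(* Let $n \ge 3$ be an integer and for real $p,q$ define $$\mathbb{G}(p,q) = \Big[(n-1)^2 q + n - 2\Big]p^2 + \Big[n(n-1)q^2 - (n^2+n-1)q - n - 2\Big]p - nq^2.$$ If $p \geq 0$, $p + q > 1$, $\frac{1}{n-1} < q < 2$ and $\mathbb{G}(p,q) < 0$, then $$p^2 + \Big[\frac{n-1}{n-2}q - \frac{n^2-3}{(n-2)^2}\Big]p + \frac{1-(n-1)q}{(n-2)^2} < 0.$$
   Context: Here $p$ and $q$ are real numbers. *)

theory Defs
  imports Complex_Main
begin

definition GG :: "int \<Rightarrow> real \<Rightarrow> real \<Rightarrow> real" where
  "GG n p q =
     ((of_int n - 1)^2 * q + of_int n - 2) * p^2
     + (of_int n * (of_int n - 1) * q^2 - ((of_int n)^2 + of_int n - 1) * q - of_int n - 2) * p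
     - of_int n * q^2"

end

theory Submission
  imports Defs
begin

text \<open>
  Let \<open>H\<close> be \<open>(n - 2)\<^sup>2\<close> times the left-hand side of the conclusion and let
  \<open>A\<close> be the leading coefficient of \<open>GG n p q\<close> in \<open>p\<close>. Then \<open>(n - 2)\<^sup>2 GG n p q - A H\<close> is linear
  in \<open>p\<close>, and its value at \<open>p = 1 - q\<close> is the nonnegative number \<open>(n - 1) (n - 2) q (q - 2)\<^sup>2\<close>.
  Its slope is positive for \<open>0 < q < 2\<close>, so it is positive for \<open>p + q > 1\<close>, and hence
  \<open>GG n p q < 0\<close> forces \<open>H < 0\<close>.
\<close>

text \<open>Pseudo-division in \<open>p\<close>: the factor \<open>(m - 2)^2\<close> makes the
  \<open>p^2\<close> terms cancel, and the linear remainder is expanded in \<open>p + q - 1\<close>,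
  whose sign the theorem fixes.\<close>

lemma GG_decomposition:
  fixes n :: int and p q :: real
  defines "m \<equiv> of_int n :: real"
  shows "(m - 2)^2 * GG n p q =
      ((m - 1)^2 * q + m - 2)
        * ((m - 2)^2 * p^2 + ((m - 1) * (m - 2) * q - (m^2 - 3)) * p + 1 - (m - 1) * q)
      + (p + q - 1) * ((m - 1) * (m - 2) * q * (2 - q) + (2 * m * (m - 2) + 1) * q + (m - 2))
      + (m - 1) * (m - 2) * q * (q - 2)^2"
  unfolding GG_def m_def by algebra

theorem lemma1p1:
  fixes n :: int and p q :: real
  assumes "n \<ge> 3"
    and "p \<ge> 0"
    and "p + q > 1"
    and "1 / (of_int n - 1) < q"
    and "q < 2"
    and "GG n p q < 0"
  shows "p^2
      + ((of_int n - 1) / (of_int n - 2) * q - ((of_int n)^2 - 3) / (of_int n - 2)^2) * p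
      + (1 - (of_int n - 1) * q) / (of_int n - 2)^2 < 0"
proof -
  define m :: real where "m = of_int n"
  define H where
    "H = (m - 2)^2 * p^2 + ((m - 1) * (m - 2) * q - (m^2 - 3)) * p + 1 - (m - 1) * q"
  define L where "L = (m - 1) * (m - 2) * q * (2 - q) + (2 * m * (m - 2) + 1) * q + (m - 2)"
  have m: "m \<ge> 3"
    using assms(1) by (simp add: m_def)
  have "0 < 1 / (m - 1)"
    using m by simp
  then have q: "0 < q" "q < 2"
    using assms(4,5) unfolding m_def by linarith+
  \<comment> \<open>\<open>L\<close> is the slope of the remainder in \<open>p\<close>; its last
    summand \<open>m - 2\<close> gives strictness.\<close>
  have "0 < L"
    unfolding L_def using m q by (intro add_nonneg_pos add_nonneg_nonneg mult_nonneg_nonneg) auto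
  then have "0 < (p + q - 1) * L"
    using assms(3) by simp
  moreover have "0 \<le> (m - 1) * (m - 2) * q * (q - 2)^2"
    using m q by (intro mult_nonneg_nonneg) auto
  moreover have "(m - 2)^2 * GG n p q < 0"
    using m assms(6) by (intro mult_pos_neg) auto
  moreover have "(m - 2)^2 * GG n p q =
      ((m - 1)^2 * q + m - 2) * H + (p + q - 1) * L + (m - 1) * (m - 2) * q * (q - 2)^2"
    unfolding H_def L_def m_def by (rule GG_decomposition)
  ultimately have "((m - 1)^2 * q + m - 2) * H < 0"
    by linarith
  \<comment> \<open>A positive leading coefficient passes the negative sign on to
    \<open>H\<close>.\<close>
  moreover have "0 < (m - 1)^2 * q + m - 2"
    using m q mult_nonneg_nonneg[of "(m - 1)^2" q] zero_le_power2[of "m - 1"] by linarith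
  ultimately have "H < 0"
    by (simp add: mult_less_0_iff)
  then have "H / (m - 2)^2 < 0"
    using m by (intro divide_neg_pos) auto
  also have "H / (m - 2)^2 = p^2 + ((m - 1) / (m - 2) * q - (m^2 - 3) / (m - 2)^2) * p
      + (1 - (m - 1) * q) / (m - 2)^2"
    using m unfolding H_def by (simp add: divide_simps) algebra
  finally show ?thesis
    unfolding m_def .
qed

end
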